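(* Every quasi-2-Segal set has fillers of all $J$-augmented horn inclusions; that is, if $X$ is a quasi-2-Segal set, then every map $\Lambda^i[n]^J_{j\to j+1}\to X$ from a $J$-augmented horn extends along the inclusion $\Lambda^i[n]^J_{j\to j+1}\hookrightarrow\Delta[n]^J_{j\to j+1}$.
   Context: $\Delta[n]$ is the standard $n$-simplex and $d_\ell\Delta[n]$ is its face opposite the vertex $\ell$. For $n\geq 3$, a subset $S\subseteq\{0,\ldots,n\}$ is broken if there exist $0\leq i<j<k<\ell\leq n$ such that either $i,k\in S$ and $j,\ell\notin S$, or $i,k\notin S$ and $j,\ell\in S$. For $n\ge 3$ and a broken two-element subset $\{i,j\}\subseteq\{0,\ldots,n\}$, the 2-Segal horn $\Lambda^{i,j}[n]\subseteq\Delta[n]$ is the union of all faces $d_\ell\Delta[n]$ with $\ell\neq i,j$. A simplicial set $X$ is a quasi-2-Segal set if every map $\Lambda^{i,j}[n]\to X$ from a 2-Segal horn extends along the inclusion $\Lambda^{i,j}[n]\hookrightarrow\Delta[n]$ to a map $\Delta[n]\to X$. $\Lambda^i[n]$ denotes the ordinary horn, the union of all faces of $\Delta[n]$ except $d_i\Delta[n]$. $J$ is the nerve of the free-living isomorphism, the category with two objects $0,1$ and exactly one morphism in each hom-set. For $n\geq 2$, $0\leq i\leq n$, and $j\in\{i-1,i\}$ with $0\leq j\leq n-1$, the $J$-augmented horn inclusion $\Lambda^i[n]^J_{j\to j+1}\hookrightarrow\Delta[n]^J_{j\to j+1}$ is obtained from the horn inclusion $\Lambda^i[n]\hookrightarrow\Delta[n]$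 by gluing a copy of $J$ (to both source and target) along the edge $j\to j+1$, i.e. taking the pushout along $\Delta[1]\hookrightarrow J$, $0\mapsto0$, $1\mapsto1$, where $\Delta[1]$ is mapped to the edge $j\to j+1$. *)

theory Defs
  imports "HOL-Library.FuncSet"
begin

section \<open>Simplicial sets\<close>

text \<open>The maps \<open>[m] \<rightarrow> [n]\<close> of the simplex category; functions are extensional, so that
  equality of functions is equality of maps.\<close>

definition simplex_maps :: "nat \<Rightarrow> nat \<Rightarrow> (nat \<Rightarrow> nat) set" where
  "simplex_maps m n = {\<alpha> \<in> {..m} \<rightarrow>\<^sub>E {..n}. mono_on {..m} \<alpha>}"

text \<open>\<open>action X m n \<alpha>\<close> is the map \<open>X\<^sub>n \<rightarrow> X\<^sub>m\<close> induced by \<open>\<alpha> : [m] \<rightarrow> [n]\<close>.\<close>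

record 'a sset =
  simplices :: "nat \<Rightarrow> 'a set"
  action :: "nat \<Rightarrow> nat \<Rightarrow> (nat \<Rightarrow> nat) \<Rightarrow> 'a \<Rightarrow> 'a"

locale simplicial_set =
  fixes X :: "'a sset"
  assumes action_closed:
      "\<lbrakk>\<alpha> \<in> simplex_maps m n; x \<in> simplices X n\<rbrakk> \<Longrightarrow> action X m n \<alpha> x \<in> simplices X m"
    and action_id:
      "x \<in> simplices X n \<Longrightarrow> action X n n (\<lambda>a\<in>{..n}. a) x = x"
    and action_compose:
      "\<lbrakk>\<beta> \<in> simplex_maps k m; \<alpha> \<in> simplex_maps m n; x \<in> simplices X n\<rbrakk>
        \<Longrightarrow> action X k n (compose {..k} \<alpha> \<beta>) x = action X k m \<beta> (action X m n \<alpha> x)"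

text \<open>Maps of simplicial sets. The values of \<open>F m\<close> outside \<open>simplices A m\<close> are irrelevant.\<close>

definition sset_map :: "'a sset \<Rightarrow> 'b sset \<Rightarrow> (nat \<Rightarrow> 'a \<Rightarrow> 'b) \<Rightarrow> bool" where
  "sset_map A B F \<longleftrightarrow>
     (\<forall>m. \<forall>x\<in>simplices A m. F m x \<in> simplices B m) \<and>
     (\<forall>m n. \<forall>\<alpha>\<in>simplex_maps m n. \<forall>x\<in>simplices A n.
        F m (action A m n \<alpha> x) = action B m n \<alpha> (F n x))"

text \<open>Every map \<open>A \<rightarrow> X\<close> extends along \<open>\<iota> : A \<rightarrow> B\<close>.\<close>

definition extends_along :: "'a sset \<Rightarrow> 'b sset \<Rightarrow> (nat \<Rightarrow> 'a \<Rightarrow> 'b) \<Rightarrow> 'x sset \<Rightarrow> bool" where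
  "extends_along A B \<iota> X \<longleftrightarrow>
     (\<forall>F. sset_map A X F \<longrightarrow>
        (\<exists>G. sset_map B X G \<and> (\<forall>m. \<forall>x\<in>simplices A m. G m (\<iota> m x) = F m x)))"

text \<open>The map \<open>\<Delta>[n] \<rightarrow> X\<close> that corresponds to \<open>x \<in> X\<^sub>n\<close> under the Yoneda lemma.\<close>

definition classifying_map :: "'a sset \<Rightarrow> nat \<Rightarrow> 'a \<Rightarrow> nat \<Rightarrow> (nat \<Rightarrow> nat) \<Rightarrow> 'a" where
  "classifying_map X n x = (\<lambda>m \<alpha>. action X m n \<alpha> x)"


section \<open>Standard simplices, horns and 2-Segal horns\<close>

definition std_simplex :: "nat \<Rightarrow> (nat \<Rightarrow> nat) sset" where
  "std_simplex n =
     \<lparr>simplices = (\<lambda>m. simplex_maps m n),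
      action = (\<lambda>k m \<beta> \<alpha>. compose {..k} \<alpha> \<beta>)\<rparr>"

text \<open>The \<open>m\<close>-simplices of the face of \<open>\<Delta>[n]\<close> opposite the vertex \<open>l\<close>.\<close>

definition face :: "nat \<Rightarrow> nat \<Rightarrow> nat \<Rightarrow> (nat \<Rightarrow> nat) set" where
  "face n l m = {\<alpha> \<in> simplices (std_simplex n) m. l \<notin> \<alpha> ` {..m}}"

definition union_of_faces :: "nat \<Rightarrow> nat set \<Rightarrow> (nat \<Rightarrow> nat) sset" where
  "union_of_faces n L =
     \<lparr>simplices = (\<lambda>m. \<Union>l\<in>L. face n l m), action = action (std_simplex n)\<rparr>"

definition horn :: "nat \<Rightarrow> nat \<Rightarrow> (nat \<Rightarrow> nat) sset" where
  "horn n i = union_of_faces n ({..n} - {i})"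

definition two_segal_horn :: "nat \<Rightarrow> nat \<Rightarrow> nat \<Rightarrow> (nat \<Rightarrow> nat) sset" where
  "two_segal_horn n i j = union_of_faces n ({..n} - {i, j})"

definition broken :: "nat \<Rightarrow> nat set \<Rightarrow> bool" where
  "broken n S \<longleftrightarrow>
     (\<exists>i j k l. i < j \<and> j < k \<and> k < l \<and> l \<le> n \<and>
        ((i \<in> S \<and> k \<in> S \<and> j \<notin> S \<and> l \<notin> S) \<or> (i \<notin> S \<and> k \<notin> S \<and> j \<in> S \<and> l \<in> S)))"

definition quasi_2_segal :: "'a sset \<Rightarrow> bool" where
  "quasi_2_segal X \<longleftrightarrow>
     simplicial_set X \<and>
     (\<forall>n i j. n \<ge> 3 \<and> i \<le> n \<and> j \<le> n \<and> i \<noteq> j \<and> broken n {i, j} \<longrightarrow>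
        extends_along (two_segal_horn n i j) (std_simplex n) (\<lambda>m x. x) X)"


section \<open>Nerves and the simplicial set \<open>J\<close>\<close>

text \<open>Composition \<open>Comp C a b c g f\<close> of \<open>f : a \<rightarrow> b\<close> and \<open>g : b \<rightarrow> c\<close> is indexed by the objects,
  so hom-sets need not be disjoint.\<close>

record ('o, 'm) category =
  Obj :: "'o set"
  Hom :: "'o \<Rightarrow> 'o \<Rightarrow> 'm set"
  Ident :: "'o \<Rightarrow> 'm"
  Comp :: "'o \<Rightarrow> 'o \<Rightarrow> 'o \<Rightarrow> 'm \<Rightarrow> 'm \<Rightarrow> 'm"

text \<open>An \<open>m\<close>-simplex of the nerve is a functor \<open>[m] \<rightarrow> C\<close>, given by its values \<open>x a\<close> on
  objects and \<open>f (a, b)\<close> on the morphisms \<open>a \<le> b\<close>.\<close>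

definition nerve :: "('o, 'm) category \<Rightarrow> ((nat \<Rightarrow> 'o) \<times> (nat \<times> nat \<Rightarrow> 'm)) sset" where
  "nerve C =
     \<lparr>simplices = (\<lambda>m. {(x, f).
        x \<in> {..m} \<rightarrow>\<^sub>E Obj C \<and>
        f \<in> (\<Pi>\<^sub>E p\<in>{(a, b). a \<le> b \<and> b \<le> m}. Hom C (x (fst p)) (x (snd p))) \<and>
        (\<forall>a\<le>m. f (a, a) = Ident C (x a)) \<and>
        (\<forall>a b c. a \<le> b \<and> b \<le> c \<and> c \<le> m \<longrightarrow>
           f (a, c) = Comp C (x a) (x b) (x c) (f (b, c)) (f (a, b)))}),
      action = (\<lambda>k m \<beta> (x, f).
        (compose {..k} x \<beta>, \<lambda>p\<in>{(a, b). a \<le> b \<and> b \<le> k}. f (\<beta> (fst p), \<beta> (snd p))))\<rparr>"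

definition free_iso :: "(nat, unit) category" where
  "free_iso =
     \<lparr>Obj = {0, 1}, Hom = (\<lambda>a b. {()}), Ident = (\<lambda>a. ()), Comp = (\<lambda>a b c g f. ())\<rparr>"

type_synonym J_simplex = "(nat \<Rightarrow> nat) \<times> (nat \<times> nat \<Rightarrow> unit)"

definition J :: "J_simplex sset" where
  "J = nerve free_iso"

text \<open>The inclusion \<open>\<Delta>[1] \<rightarrow> J\<close> with \<open>0 \<mapsto> 0\<close> and \<open>1 \<mapsto> 1\<close>.\<close>

definition J_edge :: "nat \<Rightarrow> (nat \<Rightarrow> nat) \<Rightarrow> J_simplex" where
  "J_edge = (\<lambda>m \<alpha>. (\<alpha>, \<lambda>p. ()))"


section \<open>Pushouts and \<open>J\<close>-augmentation\<close>

text \<open>The pushout of \<open>f : K \<rightarrow> A\<close> and \<open>g : K \<rightarrow> B\<close> is formed levelwise: the quotient of the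
  disjoint union \<open>A\<^sub>m + B\<^sub>m\<close> by the equivalence relation generated by \<open>f x \<sim> g x\<close>.\<close>

definition pushout_rel ::
    "'k sset \<Rightarrow> 'a sset \<Rightarrow> 'b sset \<Rightarrow> (nat \<Rightarrow> 'k \<Rightarrow> 'a) \<Rightarrow> (nat \<Rightarrow> 'k \<Rightarrow> 'b) \<Rightarrow> nat \<Rightarrow> ('a + 'b) rel" where
  "pushout_rel K A B f g m =
     (let U = simplices A m <+> simplices B m;
          r = (\<lambda>x. (Inl (f m x), Inr (g m x))) ` simplices K m
      in (r \<union> r\<inverse>)\<^sup>* \<inter> (U \<times> U))"

definition pushout ::
    "'k sset \<Rightarrow> 'a sset \<Rightarrow> 'b sset \<Rightarrow> (nat \<Rightarrow> 'k \<Rightarrow> 'a) \<Rightarrow> (nat \<Rightarrow> 'k \<Rightarrow> 'b) \<Rightarrow> ('a + 'b) set sset" where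
  "pushout K A B f g =
     \<lparr>simplices = (\<lambda>m. (simplices A m <+> simplices B m) // pushout_rel K A B f g m),
      action = (\<lambda>m n \<alpha> c.
        pushout_rel K A B f g m `` (map_sum (action A m n \<alpha>) (action B m n \<alpha>) ` c))\<rparr>"

text \<open>\<open>A\<close> with a copy of \<open>J\<close> glued along the edge \<open>e \<in> A\<^sub>1\<close>.\<close>

definition augment_rel :: "'a sset \<Rightarrow> 'a \<Rightarrow> nat \<Rightarrow> ('a + J_simplex) rel" where
  "augment_rel A e = pushout_rel (std_simplex 1) A J (classifying_map A 1 e) J_edge"

definition augment :: "'a sset \<Rightarrow> 'a \<Rightarrow> ('a + J_simplex) set sset" where
  "augment A e = pushout (std_simplex 1) A J (classifying_map A 1 e) J_edge"

text \<open>The map of pushouts induced by \<open>h : A \<rightarrow> B\<close> and the identities of \<open>J\<close> and \<open>\<Delta>[1]\<close>,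
  where the edge of \<open>B\<close> is \<open>e = h\<^sub>1 e'\<close> for the edge \<open>e'\<close> of \<open>A\<close>.\<close>

definition augment_map ::
    "'b sset \<Rightarrow> 'b \<Rightarrow> (nat \<Rightarrow> 'a \<Rightarrow> 'b) \<Rightarrow> nat \<Rightarrow> ('a + J_simplex) set \<Rightarrow> ('b + J_simplex) set" where
  "augment_map B e h = (\<lambda>m c. augment_rel B e m `` (map_sum (h m) id ` c))"

text \<open>The edge \<open>j \<rightarrow> j + 1\<close> of \<open>\<Delta>[n]\<close>, as a 1-simplex.\<close>

definition edge :: "nat \<Rightarrow> nat \<Rightarrow> nat" where
  "edge j = (\<lambda>a\<in>{..1}. j + a)"

definition J_horn :: "nat \<Rightarrow> nat \<Rightarrow> nat \<Rightarrow> ((nat \<Rightarrow> nat) + J_simplex) set sset" where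
  "J_horn n i j = augment (horn n i) (edge j)"

definition J_std_simplex :: "nat \<Rightarrow> nat \<Rightarrow> ((nat \<Rightarrow> nat) + J_simplex) set sset" where
  "J_std_simplex n j = augment (std_simplex n) (edge j)"

definition J_horn_inclusion ::
    "nat \<Rightarrow> nat \<Rightarrow> nat \<Rightarrow> ((nat \<Rightarrow> nat) + J_simplex) set \<Rightarrow> ((nat \<Rightarrow> nat) + J_simplex) set" where
  "J_horn_inclusion n j = augment_map (std_simplex n) (edge j) (\<lambda>m x. x)"

end

theory Submission
  imports Defs "HOL-Library.Infinite_Set"
begin

text \<open>
  Write \<open>a = j\<close> and \<open>b = j + 1\<close>, and let \<open>R\<close> be the set of the other vertices of \<open>\<Delta>[n]\<close>. Replace
  the edge \<open>a \<rightarrow> b\<close> by a string \<open>a \<rightarrow> b \<rightarrow> a' \<rightarrow> b'\<close> with \<open>b \<rightarrow> a'\<close> the inverse of the edge in \<open>J\<close>.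
  The map on the \<open>J\<close>-augmented horn prescribes the simplex on \<open>a, b, a', b'\<close>, and for every \<open>\<sigma>\<close>
  strictly contained in \<open>R\<close> it prescribes, as degenerate simplices, the faces of
  \<open>{a, b, a', b'} \<union> \<sigma>\<close> opposite \<open>b\<close> and opposite \<open>a'\<close>. By induction on \<open>\<sigma>\<close> the faces opposite the
  elements of \<open>\<sigma>\<close> are there as well, so a 2-Segal horn that lacks the faces opposite \<open>a\<close> and \<open>b'\<close>
  remains to be filled. Finally one fills the 2-Segal horn in \<open>{a, b, a'} \<union> R\<close> that lacks the
  faces opposite \<open>a\<close> and \<open>a'\<close> if \<open>i = a\<close>, and the one in \<open>{b, a', b'} \<union> R\<close> that lacks the faces
  opposite \<open>b\<close> and \<open>b'\<close> if \<open>i = b\<close>. The face opposite \<open>a'\<close>, respectively \<open>b\<close>, of the filler is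
  the simplex sought.\<close>

section \<open>Subcomplexes of a standard simplex\<close>

text \<open>A simplex of \<open>\<Delta>[N]\<close> belongs to a subcomplex or not according to its set of vertices,
  hence the encoding of a subcomplex by a family \<open>T\<close> of vertex sets. Only the nonempty subsets of
  \<open>{..N}\<close> in \<open>T\<close> matter.\<close>

definition subcomplex :: "nat \<Rightarrow> nat set set \<Rightarrow> (nat \<Rightarrow> nat) sset" where
  "subcomplex N T =
     \<lparr>simplices = (\<lambda>m. {\<alpha> \<in> simplex_maps m N. \<alpha> ` {..m} \<in> T}), action = action (std_simplex N)\<rparr>"

lemma subcomplex_UNIV: "subcomplex N UNIV = std_simplex N"
  by (simp add: subcomplex_def std_simplex_def)

lemma union_of_faces_eq_subcomplex: "union_of_faces n L = subcomplex n {S. \<exists>l\<in>L. l \<notin> S}"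
  by (auto simp: union_of_faces_def subcomplex_def face_def std_simplex_def)

lemma sset_map_subcomplex_iff:
  "sset_map (subcomplex N T) X F \<longleftrightarrow>
     (\<forall>m \<alpha>. \<alpha> \<in> simplex_maps m N \<longrightarrow> \<alpha> ` {..m} \<in> T \<longrightarrow> F m \<alpha> \<in> simplices X m) \<and>
     (\<forall>k m \<beta> \<alpha>. \<beta> \<in> simplex_maps k m \<longrightarrow> \<alpha> \<in> simplex_maps m N \<longrightarrow> \<alpha> ` {..m} \<in> T \<longrightarrow>
        F k (compose {..k} \<alpha> \<beta>) = action X k m \<beta> (F m \<alpha>))"
  by (auto simp: sset_map_def subcomplex_def std_simplex_def)

lemma sset_map_subcomplexI:
  assumes "\<And>m \<alpha>. \<alpha> \<in> simplex_maps m N \<Longrightarrow> \<alpha> ` {..m} \<in> T \<Longrightarrow> F m \<alpha> \<in> simplices X m"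
    and "\<And>k m \<beta> \<alpha>. \<beta> \<in> simplex_maps k m \<Longrightarrow> \<alpha> \<in> simplex_maps m N \<Longrightarrow> \<alpha> ` {..m} \<in> T \<Longrightarrow>
      F k (compose {..k} \<alpha> \<beta>) = action X k m \<beta> (F m \<alpha>)"
  shows "sset_map (subcomplex N T) X F"
  using assms by (simp add: sset_map_subcomplex_iff)

lemma sset_map_subcomplex_closed:
  assumes "sset_map (subcomplex N T) X F" "\<alpha> \<in> simplex_maps m N" "\<alpha> ` {..m} \<in> T"
  shows "F m \<alpha> \<in> simplices X m"
  using assms by (simp add: sset_map_subcomplex_iff)

lemma sset_map_subcomplex_compose:
  assumes "sset_map (subcomplex N T) X F" "\<beta> \<in> simplex_maps k m" "\<alpha> \<in> simplex_maps m N"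
    and "\<alpha> ` {..m} \<in> T"
  shows "F k (compose {..k} \<alpha> \<beta>) = action X k m \<beta> (F m \<alpha>)"
  using assms by (simp add: sset_map_subcomplex_iff)

lemma simplex_maps_compose:
  assumes "\<beta> \<in> simplex_maps k m" "\<alpha> \<in> simplex_maps m n"
  shows "compose {..k} \<alpha> \<beta> \<in> simplex_maps k n"
  using assms unfolding simplex_maps_def
  by (auto simp: compose_def monotone_on_def PiE_iff Pi_iff)

lemma image_compose_simplex:
  "compose {..k} \<alpha> \<beta> ` {..k} = \<alpha> ` \<beta> ` {..k}"
  by (auto simp: compose_def)

lemma image_simplex_map: "\<beta> \<in> simplex_maps k m \<Longrightarrow> \<beta> ` {..k} \<subseteq> {..m}"
  by (auto simp: simplex_maps_def)

lemma image_compose_subset: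
  "\<beta> \<in> simplex_maps k m \<Longrightarrow> compose {..k} \<alpha> \<beta> ` {..k} \<subseteq> \<alpha> ` {..m}"
  unfolding image_compose_simplex by (intro image_mono image_simplex_map)

lemma compose_simplex_assoc:
  assumes "\<beta> \<in> simplex_maps k m"
  shows "compose {..k} (compose {..m} e \<alpha>) \<beta> = compose {..k} e (compose {..k} \<alpha> \<beta>)"
  using image_simplex_map[OF assms] by (auto simp: compose_def fun_eq_iff)

lemma restrict_comp_simplex_map:
  assumes "\<alpha> \<in> simplex_maps m N" "mono_on (\<alpha> ` {..m}) f" "f ` \<alpha> ` {..m} \<subseteq> {..n}"
  shows "(\<lambda>a\<in>{..m}. f (\<alpha> a)) \<in> simplex_maps m n"
  using assms unfolding simplex_maps_def by (auto simp: monotone_on_def image_subset_iff)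

lemma image_restrict_comp: "(\<lambda>a\<in>{..m}. f (\<alpha> a)) ` {..m} = f ` \<alpha> ` {..m}" for m :: nat
  by auto

lemma restrict_comp_compose:
  assumes "\<beta> \<in> simplex_maps k m"
  shows "(\<lambda>a\<in>{..k}. f (compose {..k} \<alpha> \<beta> a)) = compose {..k} (\<lambda>a\<in>{..m}. f (\<alpha> a)) \<beta>"
  using image_simplex_map[OF assms] by (auto simp: compose_def fun_eq_iff)

lemma sset_map_subcomplex_pullback:
  assumes F: "sset_map (subcomplex N T) X F" and e: "e \<in> simplex_maps d N"
    and ST: "\<And>V. V \<in> S \<Longrightarrow> V \<subseteq> {..d} \<Longrightarrow> e ` V \<in> T"
  shows "sset_map (subcomplex d S) X (\<lambda>m \<alpha>. F m (compose {..m} e \<alpha>))"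
proof (rule sset_map_subcomplexI)
  fix m \<alpha> assume \<alpha>: "\<alpha> \<in> simplex_maps m d" "\<alpha> ` {..m} \<in> S"
  have im: "compose {..m} e \<alpha> ` {..m} \<in> T"
    unfolding image_compose_simplex using ST[OF \<alpha>(2) image_simplex_map[OF \<alpha>(1)]] .
  show "F m (compose {..m} e \<alpha>) \<in> simplices X m"
    by (rule sset_map_subcomplex_closed[OF F simplex_maps_compose[OF \<alpha>(1) e] im])
  fix k \<beta> assume \<beta>: "\<beta> \<in> simplex_maps k m"
  show "F k (compose {..k} e (compose {..k} \<alpha> \<beta>)) = action X k m \<beta> (F m (compose {..m} e \<alpha>))"
    using sset_map_subcomplex_compose[OF F \<beta> simplex_maps_compose[OF \<alpha>(1) e] im]
    by (simp add: compose_simplex_assoc[OF \<beta>])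
qed


section \<open>Filling one 2-Segal horn\<close>

lemma simplex_enumeration:
  assumes "\<tau> \<subseteq> {..N}" "card \<tau> = Suc d"
  obtains e where "e \<in> simplex_maps d N" "strict_mono_on {..d} e" "e ` {..d} = \<tau>"
proof -
  have "finite \<tau>" using assms(1) finite_subset by blast
  then obtain h where h: "bij_betw h {..<card \<tau>} \<tau>" "strict_mono_on {..<card \<tau>} h"
    by (rule ex_bij_betw_strict_mono_card)
  have eq: "{..<card \<tau>} = {..d}" using assms(2) by auto
  let ?e = "restrict h {..d}"
  have im: "?e ` {..d} = \<tau>" using h(1) eq by (simp add: bij_betw_def)
  moreover have "strict_mono_on {..d} ?e"
    using h(2) unfolding eq by (auto simp: monotone_on_def)
  moreover have "?e \<in> simplex_maps d N"
    unfolding simplex_maps_def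
  proof (intro CollectI conjI)
    have "?e a \<in> {..N}" if "a \<in> {..d}" for a
      using imageI[OF that, of ?e] assms(1) unfolding im by blast
    then show "?e \<in> {..d} \<rightarrow>\<^sub>E {..N}" by (intro PiE_I) auto
    show "mono_on {..d} ?e"
      using \<open>strict_mono_on {..d} ?e\<close> by (rule strict_mono_on_imp_mono_on)
  qed
  ultimately show thesis using that by blast
qed

lemma quasi_2_segal_extends:
  assumes "quasi_2_segal X" "n \<ge> 3" "i \<le> n" "j \<le> n" "i \<noteq> j" "broken n {i, j}"
    and "sset_map (subcomplex n {S. \<exists>l\<in>{..n} - {i, j}. l \<notin> S}) X F"
  shows "\<exists>G. sset_map (std_simplex n) X G \<and>
    (\<forall>m \<alpha> l. \<alpha> \<in> simplex_maps m n \<longrightarrow> l \<le> n \<longrightarrow> l \<noteq> i \<longrightarrow> l \<noteq> j \<longrightarrow> l \<notin> \<alpha> ` {..m} \<longrightarrow>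
      G m \<alpha> = F m \<alpha>)"
proof -
  have "extends_along (subcomplex n {S. \<exists>l\<in>{..n} - {i, j}. l \<notin> S}) (std_simplex n) (\<lambda>m x. x) X"
    using assms(1-6) unfolding quasi_2_segal_def two_segal_horn_def union_of_faces_eq_subcomplex
    by blast
  then obtain G where G: "sset_map (std_simplex n) X G"
    "\<forall>m. \<forall>x\<in>simplices (subcomplex n {S. \<exists>l\<in>{..n} - {i, j}. l \<notin> S}) m. G m x = F m x"
    using assms(7) unfolding extends_along_def by blast
  show ?thesis
    by (intro exI[of _ G] conjI G(1)) (use G(2) in \<open>auto simp: subcomplex_def\<close>)
qed

text \<open>\<open>k\<close> and \<open>l\<close> lie in the two arcs into which \<open>i\<close>
  and \<open>j\<close> cut the cyclically ordered vertices, so the four alternate; the side of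
  \<open>l\<close> decides the clause of \<open>broken\<close>.\<close>

lemma broken_pairI:
  assumes "i < k" "k < j" "k \<le> n" "j \<le> n" "l \<le> n" "l < i \<or> j < l"
  shows "broken n {i, j}"
proof (cases "l < i")
  case True
  show ?thesis unfolding broken_def
    by (rule exI[of _ l], rule exI[of _ i], rule exI[of _ k], rule exI[of _ j])
      (use assms True in auto)
next
  case False
  show ?thesis unfolding broken_def
    by (rule exI[of _ i], rule exI[of _ k], rule exI[of _ j], rule exI[of _ l])
      (use assms False in auto)
qed

text \<open>Attaching \<tau> to \<open>T\<close> is a pushout along a 2-Segal horn:
  \<open>faces\<close> and \<open>notin\<close>, with \<open>down\<close>, say that
  \<open>T \<inter> Pow \<tau>\<close> consists of the subsets of \<tau> that miss a vertex other
  than \<open>p\<close> and \<open>q\<close>. The vertices \<open>u\<close> and \<open>v\<close>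
  make the pair broken.\<close>

lemma extend_over_face:
  assumes X: "quasi_2_segal X"
    and F: "sset_map (subcomplex N T) X F"
    and down: "\<And>U V. U \<in> T \<Longrightarrow> V \<subseteq> U \<Longrightarrow> V \<in> T"
    and \<tau>: "\<tau> \<subseteq> {..N}" "p \<in> \<tau>" "q \<in> \<tau>" "u \<in> \<tau>" "v \<in> \<tau>"
    and ord: "p < u" "u < q" "v < p \<or> q < v"
    and faces: "\<And>l. l \<in> \<tau> \<Longrightarrow> l \<noteq> p \<Longrightarrow> l \<noteq> q \<Longrightarrow> \<tau> - {l} \<in> T"
    and notin: "\<tau> - {p, q} \<notin> T"
  obtains F' where "sset_map (subcomplex N (T \<union> Pow \<tau>)) X F'"
    "\<And>m \<alpha>. \<alpha> ` {..m} \<in> T \<Longrightarrow> F' m \<alpha> = F m \<alpha>"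
proof -
  have fin: "finite \<tau>" using \<tau>(1) finite_subset by blast
  \<comment> \<open>The four vertices are distinct, so \<tau> has dimension at least 3, as 2-Segal
    horns require.\<close>
  have "card {p, q, u, v} \<le> card \<tau>" using \<tau> fin by (intro card_mono) auto
  moreover have "card {p, q, u, v} = 4" using ord by auto
  ultimately obtain d where d: "card \<tau> = Suc d" "d \<ge> 3"
    by (cases "card \<tau>") auto
  obtain e where e: "e \<in> simplex_maps d N" "strict_mono_on {..d} e" "e ` {..d} = \<tau>"
    using simplex_enumeration[OF \<tau>(1) d(1)] by blast
  have inj: "inj_on e {..d}" using e(2) by (rule strict_mono_on_imp_inj_on)
  have less: "s < t" if "s \<le> d" "t \<le> d" "e s < e t" for s t
    using that strict_mono_on_less[OF e(2), of s t] by simp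
  obtain s t k l where st: "s \<le> d" "e s = p" "t \<le> d" "e t = q" "k \<le> d" "e k = u" "l \<le> d" "e l = v"
    using \<tau>(2-5) unfolding e(3)[symmetric] by blast
  have broken: "broken d {s, t}"
    by (rule broken_pairI[of s k t d l]) (use st ord less in auto)
  have "s \<noteq> t" using st ord by auto
  define r where "r = the_inv_into {..d} e"
  have re: "r (e x) = x" if "x \<le> d" for x
    unfolding r_def using the_inv_into_f_f[OF inj] that by simp
  have er: "e (r x) = x" "r x \<le> d" if x: "x \<in> \<tau>" for x
  proof -
    obtain z where "z \<le> d" "x = e z" using e(3) x by auto
    then show "e (r x) = x" "r x \<le> d" using re by auto
  qed
  have r_mono: "mono_on \<tau> r"
    unfolding monotone_on_def
  proof (intro ballI impI)
    fix x y assume xy: "x \<in> \<tau>" "y \<in> \<tau>" "x \<le> y"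
    show "r x \<le> r y"
      using strict_mono_onD[OF e(2), of "r y" "r x"] er[OF xy(1)] er[OF xy(2)] xy(3) by fastforce
  qed
  have pull: "(\<lambda>a\<in>{..m}. r (\<alpha> a)) \<in> simplex_maps m d"
    if "\<alpha> \<in> simplex_maps m N" "\<alpha> ` {..m} \<subseteq> \<tau>" for m \<alpha>
    by (rule restrict_comp_simplex_map[OF that(1) mono_on_subset[OF r_mono that(2)]])
      (use that er in auto)
  have push: "compose {..m} e (\<lambda>a\<in>{..m}. r (\<alpha> a)) = \<alpha>"
    if "\<alpha> \<in> simplex_maps m N" "\<alpha> ` {..m} \<subseteq> \<tau>" for m \<alpha>
  proof
    fix a show "compose {..m} e (\<lambda>a\<in>{..m}. r (\<alpha> a)) a = \<alpha> a"
using that(1) er(1)[of "\<alpha> a"] that(2)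
      by (cases "a \<le> m") (auto simp: compose_def simplex_maps_def PiE_def extensional_def)
  qed
  define H where "H = (\<lambda>m \<alpha>. F m (compose {..m} e \<alpha>))"
  have H: "sset_map (subcomplex d {S. \<exists>l\<in>{..d} - {s, t}. l \<notin> S}) X H"
    unfolding H_def
  proof (rule sset_map_subcomplex_pullback[OF F e(1)])
    fix V assume V: "V \<in> {S. \<exists>l\<in>{..d} - {s, t}. l \<notin> S}" "V \<subseteq> {..d}"
    then obtain l where l: "l \<le> d" "l \<noteq> s" "l \<noteq> t" "l \<notin> V" by auto
    have neq: "e x \<noteq> e l" if "x \<in> V \<or> x = s \<or> x = t" for x
      using inj l V(2) st that unfolding inj_on_def by auto
    have "e l \<in> \<tau>" "e l \<noteq> p" "e l \<noteq> q" using neq[of s] neq[of t] st l e(3) by auto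
    then have "\<tau> - {e l} \<in> T" by (rule faces)
    moreover have "e ` V \<subseteq> \<tau> - {e l}"
      unfolding e(3)[symmetric] image_subset_iff using neq V(2) by auto
    ultimately show "e ` V \<in> T" by (rule down)
  qed
  obtain G where G: "sset_map (std_simplex d) X G"
    "\<And>m \<alpha> l. \<lbrakk>\<alpha> \<in> simplex_maps m d; l \<le> d; l \<noteq> s; l \<noteq> t; l \<notin> \<alpha> ` {..m}\<rbrakk> \<Longrightarrow> G m \<alpha> = H m \<alpha>"
    using quasi_2_segal_extends[OF X d(2) st(1,3) \<open>s \<noteq> t\<close> broken H] by blast
  have G_map: "sset_map (subcomplex d UNIV) X G" using G(1) by (simp add: subcomplex_UNIV)
  define F' where
    "F' = (\<lambda>m \<alpha>. if \<alpha> ` {..m} \<in> T then F m \<alpha> else G m (\<lambda>a\<in>{..m}. r (\<alpha> a)))"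
  \<comment> \<open>On a face already in \<open>T\<close> the two prescriptions agree: by
    \<open>notin\<close> it misses some \<open>x\<close> in \<tau> other than \<open>p\<close> and
    \<open>q\<close>, hence lies in the horn, where \<open>G\<close> extends
    \<open>F\<close>.\<close>
  have F'G: "F' m \<alpha> = G m (\<lambda>a\<in>{..m}. r (\<alpha> a))"
    if \<alpha>: "\<alpha> \<in> simplex_maps m N" "\<alpha> ` {..m} \<subseteq> \<tau>" for m \<alpha>
  proof (cases "\<alpha> ` {..m} \<in> T")
    case True
    have "\<not> \<tau> - {p, q} \<subseteq> \<alpha> ` {..m}" using down[OF True] notin by blast
    then obtain x where x: "x \<in> \<tau>" "x \<noteq> p" "x \<noteq> q" "x \<notin> \<alpha> ` {..m}" by blast
    have "r x \<notin> (\<lambda>a\<in>{..m}. r (\<alpha> a)) ` {..m}"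
    proof
      assume "r x \<in> (\<lambda>a\<in>{..m}. r (\<alpha> a)) ` {..m}"
      then obtain a where a: "a \<le> m" "r x = r (\<alpha> a)" by auto
      then have "x = \<alpha> a" using er(1)[OF x(1)] er(1)[of "\<alpha> a"] \<alpha>(2) by auto
      then show False using x(4) a by auto
    qed
    moreover have "r x \<noteq> s" "r x \<noteq> t" using er[OF x(1)] st x by auto
    ultimately have "G m (\<lambda>a\<in>{..m}. r (\<alpha> a)) = H m (\<lambda>a\<in>{..m}. r (\<alpha> a))"
      using G(2)[OF pull[OF \<alpha>] er(2)[OF x(1)]] by blast
    also have "\<dots> = F m \<alpha>" unfolding H_def push[OF \<alpha>] ..
    finally show ?thesis using True by (simp add: F'_def)
  qed (simp add: F'_def)
  have "sset_map (subcomplex N (T \<union> Pow \<tau>)) X F'"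
  proof (rule sset_map_subcomplexI)
    fix m \<alpha> assume \<alpha>: "\<alpha> \<in> simplex_maps m N" "\<alpha> ` {..m} \<in> T \<union> Pow \<tau>"
    show "F' m \<alpha> \<in> simplices X m"
    proof (cases "\<alpha> ` {..m} \<in> T")
      case True
      then show ?thesis using sset_map_subcomplex_closed[OF F \<alpha>(1)] by (simp add: F'_def)
    next
      case False
      then have "\<alpha> ` {..m} \<subseteq> \<tau>" using \<alpha>(2) by auto
      then show ?thesis
        unfolding F'G[OF \<alpha>(1) \<open>\<alpha> ` {..m} \<subseteq> \<tau>\<close>]
        by (intro sset_map_subcomplex_closed[OF G_map pull[OF \<alpha>(1)]] UNIV_I)
    qed
    fix k \<beta> assume \<beta>: "\<beta> \<in> simplex_maps k m"
    show "F' k (compose {..k} \<alpha> \<beta>) = action X k m \<beta> (F' m \<alpha>)"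
    proof (cases "\<alpha> ` {..m} \<in> T")
      case True
      have "compose {..k} \<alpha> \<beta> ` {..k} \<in> T"
        by (rule down[OF True image_compose_subset[OF \<beta>]])
      then show ?thesis
        using sset_map_subcomplex_compose[OF F \<beta> \<alpha>(1) True] True by (simp add: F'_def)
    next
      case False
      then have sub: "\<alpha> ` {..m} \<subseteq> \<tau>" using \<alpha>(2) by auto
      have "compose {..k} \<alpha> \<beta> ` {..k} \<subseteq> \<tau>"
        by (rule order.trans[OF image_compose_subset[OF \<beta>] sub])
      from F'G[OF simplex_maps_compose[OF \<beta> \<alpha>(1)] this] show ?thesis
        unfolding restrict_comp_compose[OF \<beta>] F'G[OF \<alpha>(1) sub]
          sset_map_subcomplex_compose[OF G_map \<beta> pull[OF \<alpha>(1) sub] UNIV_I] .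
    qed
  qed
  moreover have "F' m \<alpha> = F m \<alpha>" if "\<alpha> ` {..m} \<in> T" for m \<alpha>
    using that by (simp add: F'_def)
  ultimately show thesis by (rule that)
qed


section \<open>Doubling the edge that is glued to \<open>J\<close>\<close>

lemma sset_map_subcomplex_mono:
  assumes "sset_map (subcomplex N T) X F" "\<And>V. V \<in> S \<Longrightarrow> V \<subseteq> {..N} \<Longrightarrow> V \<in> T"
  shows "sset_map (subcomplex N S) X F"
  using assms image_simplex_map unfolding sset_map_subcomplex_iff by blast

text \<open>\<open>\<gamma>\<close> may fail to be monotone: the hom-sets of the free-living
  isomorphism are singletons, so any sequence of objects is a simplex of \<open>J\<close>. This
  admits the backward edge of the string.\<close>

lemma J_edge_in_J: "\<gamma> \<in> {..m} \<rightarrow>\<^sub>E {..1} \<Longrightarrow> J_edge m \<gamma> \<in> simplices J m"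
  by (auto simp: J_def nerve_def free_iso_def J_edge_def PiE_iff extensional_def le_Suc_eq)

lemma action_J_edge: "action J k m \<beta> (J_edge m \<gamma>) = J_edge k (compose {..k} \<gamma> \<beta>)"
  by (auto simp: J_def nerve_def J_edge_def)

text \<open>A map out of the augmented horn, unpacked into its components on the horn and on
  \<open>J\<close>.\<close>

locale J_horn_map =
  fixes X :: "'a sset" and n i j :: nat
    and FA :: "nat \<Rightarrow> (nat \<Rightarrow> nat) \<Rightarrow> 'a" and FJ :: "nat \<Rightarrow> J_simplex \<Rightarrow> 'a"
  assumes X: "quasi_2_segal X"
    and n: "n \<ge> 2" and ij: "j = i \<or> j + 1 = i" and j: "j + 1 \<le> n"
    and FA: "sset_map (subcomplex n {S. \<exists>l\<in>{..n} - {i}. l \<notin> S}) X FA"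
    and FJ: "sset_map J X FJ"
    and glue: "\<And>m \<gamma>. \<gamma> \<in> simplex_maps m 1 \<Longrightarrow> FA m (compose {..m} (edge j) \<gamma>) = FJ m (J_edge m \<gamma>)"
begin

text \<open>The vertices \<open>j, j + 1, j + 2, j + 3\<close> of \<open>\<Delta>[n + 2]\<close> are two consecutive copies of the edge
  \<open>j \<rightarrow> j + 1\<close> of \<open>\<Delta>[n]\<close>; \<open>collapse\<close> identifies the copies. It is not monotone, since
  \<open>collapse (j + 1) > collapse (j + 2)\<close>, but \<open>J\<close> has an edge in this direction.\<close>

definition collapse :: "nat \<Rightarrow> nat" where
  "collapse v = (if v \<le> j + 1 then v else v - 2)"

text \<open>The vertices \<open>a\<close>, \<open>b\<close>, \<open>a'\<close>, \<open>b'\<close> of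
  the string, in this order.\<close>

definition Q :: "nat set" where
  "Q = {j, j + 1, j + 2, j + 3}"

text \<open>The faces on which the given map prescribes a value by way of \<open>collapse\<close>.
  Subsets of \<open>Q\<close> go to \<open>J\<close>, where order is immaterial; other faces must
  miss \<open>b\<close> or \<open>a'\<close>, so that \<open>collapse\<close> is monotone on them,
  and must land in the horn.\<close>

definition T0 :: "nat set set" where
  "T0 = Pow Q \<union> {S. (j + 1 \<notin> S \<or> j + 2 \<notin> S) \<and> (\<exists>l\<in>{..n} - {i}. l \<notin> collapse ` S)}"

text \<open>Subtracting \<open>j\<close> turns the ends of the edge into the objects 0 and 1 of
  \<open>J\<close>.\<close>

definition F0 :: "nat \<Rightarrow> (nat \<Rightarrow> nat) \<Rightarrow> 'a" where
  "F0 m \<alpha> = (if \<alpha> ` {..m} \<subseteq> Q then FJ m (J_edge m (\<lambda>a\<in>{..m}. collapse (\<alpha> a) - j))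
     else FA m (\<lambda>a\<in>{..m}. collapse (\<alpha> a)))"

lemma T0_down: "U \<in> T0 \<Longrightarrow> V \<subseteq> U \<Longrightarrow> V \<in> T0"
  unfolding T0_def by blast

lemma mono_on_collapse: "j + 1 \<notin> S \<or> j + 2 \<notin> S \<Longrightarrow> mono_on S collapse"
proof (rule monotone_onI)
  fix x y assume *: "j + 1 \<notin> S \<or> j + 2 \<notin> S" "x \<in> S" "y \<in> S" "x \<le> y"
  \<comment> \<open>This is the only pair that \<open>collapse\<close> puts in the wrong
    order.\<close>
  then have "\<not> (x = j + 1 \<and> y = j + 2)" by blast
  with * show "collapse x \<le> collapse y" by (auto simp: collapse_def)
qed

lemma collapse_le: "v \<le> n + 2 \<Longrightarrow> collapse v \<le> n"
  using j by (auto simp: collapse_def)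

lemma collapse_Q: "v \<in> Q \<Longrightarrow> collapse v = j \<or> collapse v = j + 1"
  by (auto simp: collapse_def Q_def)

lemma collapse_simplex_map:
  assumes "\<alpha> \<in> simplex_maps m (n + 2)" "j + 1 \<notin> \<alpha> ` {..m} \<or> j + 2 \<notin> \<alpha> ` {..m}"
  shows "(\<lambda>a\<in>{..m}. collapse (\<alpha> a)) \<in> simplex_maps m n"
  by (rule restrict_comp_simplex_map[OF assms(1) mono_on_collapse[OF assms(2)]])
    (use image_simplex_map[OF assms(1)] collapse_le in auto)

text \<open>Where \<open>collapse\<close> is monotone, a simplex on \<open>Q\<close> factors through
  the edge \<open>j \<rightarrow> j + 1\<close>, along which \<open>glue\<close> identifies the two
  clauses of \<open>F0\<close>.\<close>

lemma F0_eq_FA: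
  assumes \<alpha>: "\<alpha> \<in> simplex_maps m (n + 2)" "j + 1 \<notin> \<alpha> ` {..m} \<or> j + 2 \<notin> \<alpha> ` {..m}"
  shows "F0 m \<alpha> = FA m (\<lambda>a\<in>{..m}. collapse (\<alpha> a))"
proof (cases "\<alpha> ` {..m} \<subseteq> Q")
  case True
  let ?\<gamma> = "\<lambda>a\<in>{..m}. collapse (\<alpha> a) - j"
  have c: "collapse (\<alpha> a) = j \<or> collapse (\<alpha> a) = j + 1" if "a \<le> m" for a
    using collapse_Q True that by auto
  have "mono_on (\<alpha> ` {..m}) (\<lambda>v. collapse v - j)"
    using mono_on_collapse[OF \<alpha>(2)] unfolding monotone_on_def by (meson diff_le_mono)
  then have "?\<gamma> \<in> simplex_maps m 1"
    by (rule restrict_comp_simplex_map[OF \<alpha>(1)]) (use c in fastforce)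
  moreover have "compose {..m} (edge j) ?\<gamma> = (\<lambda>a\<in>{..m}. collapse (\<alpha> a))"
  proof
    fix a show "compose {..m} (edge j) ?\<gamma> a = (\<lambda>a\<in>{..m}. collapse (\<alpha> a)) a"
      using c[of a] by (auto simp: compose_def edge_def)
  qed
  ultimately show ?thesis using glue[of ?\<gamma> m] True by (simp add: F0_def)
qed (simp add: F0_def)

lemma F0_map: "sset_map (subcomplex (n + 2) T0) X F0"
proof (rule sset_map_subcomplexI)
  fix m \<alpha> assume \<alpha>: "\<alpha> \<in> simplex_maps m (n + 2)" "\<alpha> ` {..m} \<in> T0"
  let ?\<gamma> = "\<lambda>a\<in>{..m}. collapse (\<alpha> a) - j" and ?\<delta> = "\<lambda>a\<in>{..m}. collapse (\<alpha> a)"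
  have J: "J_edge m ?\<gamma> \<in> simplices J m" if "\<alpha> ` {..m} \<subseteq> Q"
  proof (rule J_edge_in_J)
    have "collapse (\<alpha> a) - j \<in> {..1}" if "a \<in> {..m}" for a
      using collapse_Q[of "\<alpha> a"] \<open>\<alpha> ` {..m} \<subseteq> Q\<close> that by fastforce
    then show "?\<gamma> \<in> {..m} \<rightarrow>\<^sub>E {..1}" by (intro PiE_I) auto
  qed
  have notQ: "j + 1 \<notin> \<alpha> ` {..m} \<or> j + 2 \<notin> \<alpha> ` {..m}" "?\<delta> ` {..m} \<in> {S. \<exists>l\<in>{..n} - {i}. l \<notin> S}"
    if "\<not> \<alpha> ` {..m} \<subseteq> Q"
    using \<alpha>(2) that unfolding T0_def image_restrict_comp by auto
  show "F0 m \<alpha> \<in> simplices X m"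
  proof (cases "\<alpha> ` {..m} \<subseteq> Q")
    case True
    then show ?thesis using J FJ by (simp add: F0_def sset_map_def)
  next
    case False
    then show ?thesis
      using sset_map_subcomplex_closed[OF FA collapse_simplex_map[OF \<alpha>(1)]] notQ
      by (simp add: F0_def)
  qed
  fix k \<beta> assume \<beta>: "\<beta> \<in> simplex_maps k m"
  have sub: "compose {..k} \<alpha> \<beta> ` {..k} \<subseteq> \<alpha> ` {..m}" by (rule image_compose_subset[OF \<beta>])
  show "F0 k (compose {..k} \<alpha> \<beta>) = action X k m \<beta> (F0 m \<alpha>)"
  proof (cases "\<alpha> ` {..m} \<subseteq> Q")
    case True
    have "FJ k (action J k m \<beta> (J_edge m ?\<gamma>)) = action X k m \<beta> (FJ m (J_edge m ?\<gamma>))"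
      using FJ J[OF True] \<beta> by (simp add: sset_map_def)
    then show ?thesis
      using order.trans[OF sub True] True
      unfolding action_J_edge
      by (simp add: F0_def restrict_comp_compose[OF \<beta>, of "\<lambda>v. collapse v - j"])
  next
    case False
    note sset_map_subcomplex_compose[OF FA \<beta> collapse_simplex_map[OF \<alpha>(1) notQ(1)[OF False]]
        notQ(2)[OF False]]
    \<comment> \<open>The restricted simplex may lie in \<open>Q\<close> although \<alpha> does not,
      so \<open>F0_eq_FA\<close> evaluates it, whichever clause of \<open>F0\<close>
      applies.\<close>
    moreover have "j + 1 \<notin> compose {..k} \<alpha> \<beta> ` {..k} \<or> j + 2 \<notin> compose {..k} \<alpha> \<beta> ` {..k}"
      using notQ(1)[OF False] sub by blast
    note F0_eq_FA[OF simplex_maps_compose[OF \<beta> \<alpha>(1)] this]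
    ultimately show ?thesis
      unfolding restrict_comp_compose[OF \<beta>] F0_eq_FA[OF \<alpha>(1) notQ(1)[OF False]] by simp
  qed
qed

text \<open>\<open>D\<close> collects the sets of further vertices whose join with the doubled edge is adjoined
  to \<open>T0\<close>.\<close>

definition TD :: "nat set set \<Rightarrow> nat set set" where
  "TD D = T0 \<union> {S. S - Q \<in> D}"

definition R :: "nat set" where
  "R = {..n + 2} - Q"

text \<open>A set that misses \<open>r\<close> has an image that misses \<open>collapse r\<close>.
  As \<open>i\<close> is an end of the edge, this yields the vertex that membership in
  \<open>T0\<close> asks for.\<close>

lemma collapse_R:
  assumes "r \<in> R"
  shows "collapse r \<noteq> j" "collapse r \<noteq> j + 1" "collapse r \<le> n"
    and "v \<noteq> r \<Longrightarrow> collapse v \<noteq> collapse r"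
  using assms collapse_le by (auto simp: R_def Q_def collapse_def)

text \<open>Removing a maximal \<sigma> keeps \<open>D\<close> closed under subsets; the face
  \<open>Q \<union> \<sigma>\<close> is then attached last, along the 2-Segal horn without the faces
  opposite \<open>j\<close> and \<open>j + 3\<close>.\<close>

lemma extend_TD:
  assumes "finite D" "D \<subseteq> Pow R - {R}" "\<forall>U\<in>D. \<forall>V\<subseteq>U. V \<in> D"
  shows "\<exists>F. sset_map (subcomplex (n + 2) (TD D)) X F \<and>
    (\<forall>m \<alpha>. \<alpha> ` {..m} \<in> T0 \<longrightarrow> F m \<alpha> = F0 m \<alpha>)"
  using assms
proof (induction D rule: finite_psubset_induct)
  case (psubset D)
  show ?case
  proof (cases "D = {}")
    case True
    then show ?thesis using F0_map by (intro exI[of _ F0]) (simp add: TD_def)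
  next
    case False
    then obtain \<sigma> where \<sigma>: "\<sigma> \<in> D" "\<forall>V\<in>D. \<sigma> \<subseteq> V \<longrightarrow> \<sigma> = V"
      using finite_has_maximal[OF psubset.hyps] by metis
    define E where "E = D - {\<sigma>}"
    have E_down: "V \<in> E" if "U \<in> E" "V \<subseteq> U" for U V
      using that \<sigma> psubset.prems(2) unfolding E_def by blast
    have "E \<subset> D" "E \<subseteq> Pow R - {R}" using \<sigma>(1) psubset.prems(1) unfolding E_def by auto
    then obtain F where F: "sset_map (subcomplex (n + 2) (TD E)) X F"
      "\<forall>m \<alpha>. \<alpha> ` {..m} \<in> T0 \<longrightarrow> F m \<alpha> = F0 m \<alpha>"
      using psubset.IH[of E] E_down by blast
    show ?thesis
    proof (cases "\<sigma> = {}")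
      case True
      \<comment> \<open>The face \<open>Q\<close> itself is already in \<open>T0\<close>, where
        \<open>J\<close> provides it.\<close>
      have "TD D \<subseteq> TD E" unfolding TD_def T0_def E_def True by blast
      then show ?thesis
        using sset_map_subcomplex_mono[OF F(1), of "TD D"] F(2) by blast
    next
      case False
      \<comment> \<open>\<open>v\<close> lies outside \<open>Q\<close> and makes the pair
        \<open>j\<close>, \<open>j + 3\<close> broken.\<close>
      then obtain v where v: "v \<in> \<sigma>" by blast
      have \<sigma>R: "\<sigma> \<subseteq> R" "\<sigma> \<noteq> R" using \<sigma>(1) psubset.prems(1) by auto
      \<comment> \<open>\<open>r\<close> exists since \<sigma> is proper in \<open>R\<close>; it
        puts the faces opposite \<open>j + 1\<close> and \<open>j + 2\<close> into
        \<open>T0\<close>.\<close>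
      then obtain r where r: "r \<in> R" "r \<notin> \<sigma>" by blast
      have R: "R \<subseteq> {..n + 2}" "R \<inter> Q = {}" by (auto simp: R_def)
      have diff: "(Q \<union> \<sigma> - A) - Q = \<sigma> - A" for A using \<sigma>R R by blast
      have down: "V \<in> TD E" if "U \<in> TD E" "V \<subseteq> U" for U V
        using that T0_down E_down[of "U - Q" "V - Q"] unfolding TD_def by blast
      have faces: "Q \<union> \<sigma> - {l} \<in> TD E" if l: "l \<in> Q \<union> \<sigma>" "l \<noteq> j" "l \<noteq> j + 3" for l
      proof (cases "l \<in> \<sigma>")
        case True
        have "\<sigma> - {l} \<in> D" using \<sigma>(1) psubset.prems(2) by blast
        then show ?thesis using True by (auto simp: TD_def E_def diff)
      next
        case False
        then have "l = j + 1 \<or> l = j + 2" using l by (auto simp: Q_def)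
        moreover have "collapse r \<notin> collapse ` (Q \<union> \<sigma> - {l})"
        proof
          assume "collapse r \<in> collapse ` (Q \<union> \<sigma> - {l})"
          then obtain w where "w \<in> Q \<union> \<sigma>" "collapse r = collapse w" by auto
          then show False using collapse_R(4)[OF r(1), of w] r R by auto
        qed
        moreover have "collapse r \<in> {..n} - {i}" using collapse_R[OF r(1)] ij by auto
        ultimately show ?thesis unfolding TD_def T0_def by blast
      qed
      \<comment> \<open>This face keeps both \<open>j + 1\<close> and \<open>j + 2\<close> and has a
        vertex outside \<open>Q\<close>, which excludes \<open>T0\<close>; off \<open>Q\<close> it
        is \<sigma>, which \<open>E\<close> omits.\<close>
      have notin: "Q \<union> \<sigma> - {j, j + 3} \<notin> TD E"
      proof -
        have "j + 1 \<in> Q \<union> \<sigma> - {j, j + 3}" "j + 2 \<in> Q \<union> \<sigma> - {j, j + 3}"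
          by (auto simp: Q_def)
        moreover have "\<not> Q \<union> \<sigma> - {j, j + 3} \<subseteq> Q" "\<sigma> - {j, j + 3} = \<sigma>"
          using v \<sigma>R R by (auto simp: Q_def)
        ultimately show ?thesis unfolding TD_def T0_def E_def by (simp add: diff)
      qed
      obtain F' where F': "sset_map (subcomplex (n + 2) (TD E \<union> Pow (Q \<union> \<sigma>))) X F'"
        "\<And>m \<alpha>. \<alpha> ` {..m} \<in> TD E \<Longrightarrow> F' m \<alpha> = F m \<alpha>"
      proof (rule extend_over_face[OF X F(1) down _ _ _ _ _ _ _ _ faces notin])
        show "Q \<union> \<sigma> \<subseteq> {..n + 2}" using \<sigma>R R j by (auto simp: Q_def)
        show "j \<in> Q \<union> \<sigma>" "j + 3 \<in> Q \<union> \<sigma>" "j + 1 \<in> Q \<union> \<sigma>" by (auto simp: Q_def)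
        show "v \<in> Q \<union> \<sigma>" using v by auto
        show "v < j \<or> j + 3 < v" using v \<sigma>R by (auto simp: R_def Q_def)
      qed auto
      have "TD D \<subseteq> TD E \<union> Pow (Q \<union> \<sigma>)" unfolding TD_def E_def by blast
      then have "sset_map (subcomplex (n + 2) (TD D)) X F'"
        using sset_map_subcomplex_mono[OF F'(1)] by blast
      moreover have "\<forall>m \<alpha>. \<alpha> ` {..m} \<in> T0 \<longrightarrow> F' m \<alpha> = F0 m \<alpha>"
        using F'(2) F(2) by (simp add: TD_def)
      ultimately show ?thesis by blast
    qed
  qed
qed

section \<open>Filling the horn by one further 2-Segal horn\<close>

text \<open>The part common to the two cases of \<open>i\<close>. The map \<delta> is a section of
  \<open>collapse\<close> with values in \<tau>; the filler is the extension over \<tau> pulled back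
  along \<delta>. On the horn this is \<open>FA\<close>, since \<delta> misses \<open>j + 1\<close>
  or \<open>j + 2\<close>, so that \<open>F0\<close> is there \<open>FA\<close> after
  \<open>collapse\<close>.\<close>

lemma fill_horn_via:
  assumes \<tau>: "\<tau> \<subseteq> {..n + 2}" "p \<in> \<tau>" "q \<in> \<tau>" "u \<in> \<tau>" "v \<in> \<tau>"
    and ord: "p < u" "u < q" "v < p \<or> q < v"
    and faces: "\<And>l. l \<in> \<tau> \<Longrightarrow> l \<noteq> p \<Longrightarrow> l \<noteq> q \<Longrightarrow> \<tau> - {l} \<in> TD (Pow R - {R})"
    and notin: "\<tau> - {p, q} \<notin> TD (Pow R - {R})"
    and \<delta>: "mono_on {..n} \<delta>" "\<delta> ` {..n} \<subseteq> \<tau>" "\<And>v. v \<le> n \<Longrightarrow> collapse (\<delta> v) = v"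
      "j + 1 \<notin> \<delta> ` {..n} \<or> j + 2 \<notin> \<delta> ` {..n}"
  shows "\<exists>G. sset_map (std_simplex n) X G \<and>
    (\<forall>m \<alpha> l. \<alpha> \<in> simplex_maps m n \<longrightarrow> l \<in> {..n} - {i} \<longrightarrow> l \<notin> \<alpha> ` {..m} \<longrightarrow> G m \<alpha> = FA m \<alpha>)"
proof -
  \<comment> \<open>With this \<open>D\<close>, every face of \<open>\<Delta>[n + 2]\<close> that
    does not contain all of \<open>R\<close> is available.\<close>
  let ?D = "Pow R - {R}"
  have "finite ?D" by (simp add: R_def)
  moreover have "\<forall>U\<in>?D. \<forall>V\<subseteq>U. V \<in> ?D" by auto
  ultimately obtain F where F: "sset_map (subcomplex (n + 2) (TD ?D)) X F"
    "\<forall>m \<alpha>. \<alpha> ` {..m} \<in> T0 \<longrightarrow> F m \<alpha> = F0 m \<alpha>"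
    using extend_TD[of ?D] by blast
  have down: "V \<in> TD ?D" if "U \<in> TD ?D" "V \<subseteq> U" for U V
    using that T0_down unfolding TD_def by blast
  obtain F' where F': "sset_map (subcomplex (n + 2) (TD ?D \<union> Pow \<tau>)) X F'"
    "\<And>m \<alpha>. \<alpha> ` {..m} \<in> TD ?D \<Longrightarrow> F' m \<alpha> = F m \<alpha>"
    by (rule extend_over_face[OF X F(1) down \<tau> ord faces notin]) auto
  let ?e = "restrict \<delta> {..n}"
  have e: "?e \<in> simplex_maps n (n + 2)"
    using \<delta>(1,2) \<tau>(1) unfolding simplex_maps_def by (auto simp: monotone_on_def)
  define G where "G = (\<lambda>m \<alpha>. F' m (compose {..m} ?e \<alpha>))"
  have "sset_map (subcomplex n UNIV) X G"
    unfolding G_def by (rule sset_map_subcomplex_pullback[OF F'(1) e]) (use \<delta>(2) in auto)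
  then have "sset_map (std_simplex n) X G" by (simp only: subcomplex_UNIV)
  moreover have "G m \<alpha> = FA m \<alpha>"
    if \<alpha>: "\<alpha> \<in> simplex_maps m n" and l: "l \<in> {..n} - {i}" "l \<notin> \<alpha> ` {..m}" for m \<alpha> l
  proof -
    let ?\<alpha> = "compose {..m} ?e \<alpha>"
    have le: "\<alpha> a \<le> n" if "a \<le> m" for a using image_simplex_map[OF \<alpha>] that by auto
    then have im: "?\<alpha> ` {..m} \<subseteq> \<delta> ` {..n}" by (auto simp: compose_def)
    then have avoids: "j + 1 \<notin> ?\<alpha> ` {..m} \<or> j + 2 \<notin> ?\<alpha> ` {..m}" using \<delta>(4) by blast
    have retract: "(\<lambda>a\<in>{..m}. collapse (?\<alpha> a)) = \<alpha>"
    proof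
      fix a show "(\<lambda>a\<in>{..m}. collapse (?\<alpha> a)) a = \<alpha> a"
        using \<alpha> le[of a] \<delta>(3)
        by (cases "a \<le> m") (auto simp: compose_def simplex_maps_def PiE_def extensional_def)
    qed
    have "collapse ` ?\<alpha> ` {..m} = \<alpha> ` {..m}"
      using image_restrict_comp[of collapse ?\<alpha> m] unfolding retract by simp
    then have "?\<alpha> ` {..m} \<in> T0" unfolding T0_def using avoids l by blast
    then have "G m \<alpha> = F0 m ?\<alpha>" using F'(2) F(2) by (simp add: G_def TD_def)
    also have "\<dots> = FA m \<alpha>"
      unfolding F0_eq_FA[OF simplex_maps_compose[OF \<alpha> e] avoids] retract ..
    finally show ?thesis .
  qed
  ultimately show ?thesis by blast
qed

lemma T0_I: "j + 1 \<notin> S \<or> j + 2 \<notin> S \<Longrightarrow> l \<le> n \<Longrightarrow> l \<noteq> i \<Longrightarrow> l \<notin> collapse ` S \<Longrightarrow> S \<in> T0"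
  unfolding T0_def by auto

lemma fill_horn:
  "\<exists>G. sset_map (std_simplex n) X G \<and>
    (\<forall>m \<alpha> l. \<alpha> \<in> simplex_maps m n \<longrightarrow> l \<in> {..n} - {i} \<longrightarrow> l \<notin> \<alpha> ` {..m} \<longrightarrow> G m \<alpha> = FA m \<alpha>)"
proof -
  \<comment> \<open>A vertex outside \<open>Q\<close>, within range as \<open>n \<ge> 2\<close>. It
    is the fourth vertex that breaks the pair, on a side of \<open>Q\<close> where there is
    room.\<close>
  define v :: nat where "v = (if j = 0 then 4 else 0)"
  have v: "v < j \<or> j + 3 < v" "v \<le> n + 2" using n by (auto simp: v_def)
  have R_image: "l \<in> collapse ` R" if "l \<le> n" "l \<noteq> j" "l \<noteq> j + 1" for l
  proof (cases "l < j")
    case True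
    then have "l \<in> R" "collapse l = l" using that by (auto simp: R_def Q_def collapse_def)
    then show ?thesis by force
  next
    case False
    then have "l + 2 \<in> R" "collapse (l + 2) = l" using that by (auto simp: R_def Q_def collapse_def)
    then show ?thesis by force
  qed
  \<comment> \<open>The image of \<open>R\<close> covers all vertices but \<open>j\<close> and
    \<open>j + 1\<close>, and \<open>i'\<close> supplies the one of these that is not
    \<open>i\<close>; so the image of \<open>S\<close> is too large for the horn.\<close>
  have not_T0: "S \<notin> T0" if "R \<subseteq> S" "i' \<in> S" "collapse i' \<in> {j, j + 1} - {i}" for S i'
  proof
    assume "S \<in> T0"
    moreover have "v \<in> S" "v \<notin> Q" using v \<open>R \<subseteq> S\<close> by (auto simp: R_def Q_def)
    ultimately obtain l where l: "l \<le> n" "l \<noteq> i" "l \<notin> collapse ` S" unfolding T0_def by blast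
    then have "l = j \<or> l = j + 1" using R_image \<open>R \<subseteq> S\<close> by blast
    then have "l = collapse i'" using that(3) l(2) ij by auto
    then show False using l(3) \<open>i' \<in> S\<close> by blast
  qed
  from ij show ?thesis
  proof
    assume "j = i"
    then have i: "i = j" ..
    \<comment> \<open>Here \<open>b'\<close> is dropped. The filler is the face opposite
      \<open>a'\<close>, so \<delta> skips \<open>j + 2\<close> along with
      \<open>j + 3\<close>.\<close>
    let ?\<tau> = "{..n + 2} - {j + 3}"
    show ?thesis
    proof (rule fill_horn_via[where \<tau> = ?\<tau> and p = j and q = "j + 2" and u = "j + 1" and v = v
          and \<delta> = "\<lambda>v. if v \<le> j + 1 then v else v + 2"])
      fix l assume l: "l \<in> ?\<tau>" "l \<noteq> j" "l \<noteq> j + 2"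
      show "?\<tau> - {l} \<in> TD (Pow R - {R})"
      proof (cases "l = j + 1")
        case True
        \<comment> \<open>Without \<open>b\<close> and \<open>b'\<close> nothing collapses to
          \<open>j + 1\<close>, a vertex other than \<open>i\<close>.\<close>
        have "j + 1 \<notin> collapse ` (?\<tau> - {l})" using True by (auto simp: collapse_def)
        then have "?\<tau> - {l} \<in> T0" using i j True by (intro T0_I[of _ "j + 1"]) auto
        then show ?thesis by (simp add: TD_def)
      next
        case False
        then have "l \<in> R" "?\<tau> - {l} - Q \<subseteq> R - {l}" using l by (auto simp: R_def Q_def)
        then show ?thesis unfolding TD_def by blast
      qed
    next
      have "?\<tau> - {j, j + 2} - Q = R" by (auto simp: R_def Q_def)
      moreover have "?\<tau> - {j, j + 2} \<notin> T0"
        by (rule not_T0[of _ "j + 1"]) (use i j in \<open>auto simp: R_def Q_def collapse_def\<close>)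
      ultimately show "?\<tau> - {j, j + 2} \<notin> TD (Pow R - {R})" by (simp add: TD_def)
    qed (use v j in \<open>auto simp: monotone_on_def collapse_def\<close>)
  next
    assume i: "j + 1 = i"
    \<comment> \<open>Here \<open>a\<close> is dropped, and \<delta> passes through
      \<open>a' \<rightarrow> b'\<close>, on the face opposite \<open>b\<close>.\<close>
    let ?\<tau> = "{..n + 2} - {j}"
    show ?thesis
    proof (rule fill_horn_via[where \<tau> = ?\<tau> and p = "j + 1" and q = "j + 3" and u = "j + 2"
          and v = v and \<delta> = "\<lambda>v. if v < j then v else v + 2"])
      fix l assume l: "l \<in> ?\<tau>" "l \<noteq> j + 1" "l \<noteq> j + 3"
      show "?\<tau> - {l} \<in> TD (Pow R - {R})"
      proof (cases "l = j + 2")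
        case True
        have "j \<notin> collapse ` (?\<tau> - {l})" using True by (auto simp: collapse_def)
        then have "?\<tau> - {l} \<in> T0" using i j True by (intro T0_I[of _ j]) auto
        then show ?thesis by (simp add: TD_def)
      next
        case False
        then have "l \<in> R" "?\<tau> - {l} - Q \<subseteq> R - {l}" using l by (auto simp: R_def Q_def)
        then show ?thesis unfolding TD_def by blast
      qed
    next
      have "?\<tau> - {j + 1, j + 3} - Q = R" by (auto simp: R_def Q_def)
      moreover have "?\<tau> - {j + 1, j + 3} \<notin> T0"
        by (rule not_T0[of _ "j + 2"]) (use i j in \<open>auto simp: R_def Q_def collapse_def\<close>)
      ultimately show "?\<tau> - {j + 1, j + 3} \<notin> TD (Pow R - {R})" by (simp add: TD_def)
    qed (use v j in \<open>auto simp: monotone_on_def collapse_def\<close>)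
  qed
qed

end


section \<open>The universal property of the pushout\<close>

lemma equiv_pushout_rel:
  "equiv (simplices A m <+> simplices B m) (pushout_rel K A B f g m)"
proof (rule equivI)
  show "refl_on (simplices A m <+> simplices B m) (pushout_rel K A B f g m)"
    by (auto simp: refl_on_def pushout_rel_def Let_def)
  show "sym (pushout_rel K A B f g m)"
    unfolding pushout_rel_def Let_def
    by (intro sym_Int sym_rtrancl sym_Un_converse) (auto simp: sym_def)
  show "trans (pushout_rel K A B f g m)"
    unfolding pushout_rel_def Let_def by (intro trans_Int trans_rtrancl) (auto simp: trans_def)
qed (auto simp: pushout_rel_def Let_def)

text \<open>The relation is generated by the glued pairs, so \<open>h\<close> is constant along
  chains of them. With \<open>h\<close> a class, this shows that the action respects the relation;
  with \<open>h\<close> a copairing, that the induced map does not depend on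
  representatives.\<close>

lemma pushout_rel_eq:
  assumes "(u, v) \<in> pushout_rel K A B f g m"
    and "\<And>x. x \<in> simplices K m \<Longrightarrow> h (Inl (f m x)) = h (Inr (g m x))"
  shows "h u = h v"
proof -
  have "(u, v) \<in> ((\<lambda>x. (Inl (f m x), Inr (g m x))) ` simplices K m \<union>
      ((\<lambda>x. (Inl (f m x), Inr (g m x))) ` simplices K m)\<inverse>)\<^sup>*"
    using assms(1) by (simp add: pushout_rel_def Let_def)
  then show ?thesis by induction (use assms(2) in force)+
qed

locale pushout_square =
  fixes K :: "'k sset" and A :: "'a sset" and B :: "'b sset"
    and f :: "nat \<Rightarrow> 'k \<Rightarrow> 'a" and g :: "nat \<Rightarrow> 'k \<Rightarrow> 'b"
  assumes closed_K: "\<And>k m \<beta> x. \<beta> \<in> simplex_maps k m \<Longrightarrow> x \<in> simplices K m \<Longrightarrow>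
      action K k m \<beta> x \<in> simplices K k"
    and closed_A: "\<And>k m \<beta> x. \<beta> \<in> simplex_maps k m \<Longrightarrow> x \<in> simplices A m \<Longrightarrow>
      action A k m \<beta> x \<in> simplices A k"
    and closed_B: "\<And>k m \<beta> x. \<beta> \<in> simplex_maps k m \<Longrightarrow> x \<in> simplices B m \<Longrightarrow>
      action B k m \<beta> x \<in> simplices B k"
    and f: "sset_map K A f" and g: "sset_map K B g"
begin

abbreviation U :: "nat \<Rightarrow> ('a + 'b) set" where
  "U m \<equiv> simplices A m <+> simplices B m"

abbreviation rel :: "nat \<Rightarrow> ('a + 'b) rel" where
  "rel m \<equiv> pushout_rel K A B f g m"

abbreviation act :: "nat \<Rightarrow> nat \<Rightarrow> (nat \<Rightarrow> nat) \<Rightarrow> 'a + 'b \<Rightarrow> 'a + 'b" where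
  "act k m \<beta> \<equiv> map_sum (action A k m \<beta>) (action B k m \<beta>)"

lemma simplices_pushout: "simplices (pushout K A B f g) m = U m // rel m"
  by (simp add: pushout_def)

lemma act_closed: "\<beta> \<in> simplex_maps k m \<Longrightarrow> u \<in> U m \<Longrightarrow> act k m \<beta> u \<in> U k"
  using closed_A closed_B by (auto simp: Plus_def)

lemma class_Inl_eq_Inr:
  assumes "x \<in> simplices K m"
  shows "rel m `` {Inl (f m x)} = rel m `` {Inr (g m x)}"
proof (rule equiv_class_eq[OF equiv_pushout_rel])
  have "f m x \<in> simplices A m" "g m x \<in> simplices B m"
    using f g assms by (auto simp: sset_map_def)
  then show "(Inl (f m x), Inr (g m x)) \<in> rel m"
    unfolding pushout_rel_def Let_def using assms by blast
qed

lemma rel_act: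
  assumes "(u, v) \<in> rel m" and \<beta>: "\<beta> \<in> simplex_maps k m"
  shows "(act k m \<beta> u, act k m \<beta> v) \<in> rel k"
proof -
  have uv: "u \<in> U m" "v \<in> U m" using assms(1) by (auto simp: pushout_rel_def Let_def)
  have "rel k `` {act k m \<beta> u} = rel k `` {act k m \<beta> v}"
  proof (rule pushout_rel_eq[OF assms(1)])
    fix x assume x: "x \<in> simplices K m"
    have "act k m \<beta> (Inl (f m x)) = Inl (f k (action K k m \<beta> x))"
      "act k m \<beta> (Inr (g m x)) = Inr (g k (action K k m \<beta> x))"
      using f g x \<beta> by (auto simp: sset_map_def)
    then show "rel k `` {act k m \<beta> (Inl (f m x))} = rel k `` {act k m \<beta> (Inr (g m x))}"
      using class_Inl_eq_Inr[OF closed_K[OF \<beta> x]] by simp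
  qed
  then show ?thesis
    using eq_equiv_class[OF _ equiv_pushout_rel act_closed[OF \<beta> uv(2)]] by blast
qed

text \<open>The action on a class is defined on all its elements and then saturated; by
  \<open>rel_act\<close> one representative suffices.\<close>

lemma action_class:
  assumes "u \<in> U m" and \<beta>: "\<beta> \<in> simplex_maps k m"
  shows "action (pushout K A B f g) k m \<beta> (rel m `` {u}) = rel k `` {act k m \<beta> u}"
proof -
  have "rel k `` (act k m \<beta> ` (rel m `` {u})) = rel k `` {act k m \<beta> u}"
  proof
    show "rel k `` (act k m \<beta> ` (rel m `` {u})) \<subseteq> rel k `` {act k m \<beta> u}"
      using rel_act[OF _ \<beta>] equiv_pushout_rel[THEN equivE] by (blast dest: transD)
    show "rel k `` {act k m \<beta> u} \<subseteq> rel k `` (act k m \<beta> ` (rel m `` {u}))"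
      using equiv_class_self[OF equiv_pushout_rel assms(1)] by blast
  qed
  then show ?thesis by (simp add: pushout_def)
qed

lemma sset_map_inclusions:
  assumes F: "sset_map (pushout K A B f g) X F"
  shows "sset_map A X (\<lambda>m x. F m (rel m `` {Inl x}))"
    and "sset_map B X (\<lambda>m y. F m (rel m `` {Inr y}))"
proof -
  have *: "F m (rel m `` {u}) \<in> simplices X m"
    "\<beta> \<in> simplex_maps k m \<Longrightarrow>
      F k (rel k `` {act k m \<beta> u}) = action X k m \<beta> (F m (rel m `` {u}))"
    if u: "u \<in> U m" for m u k \<beta>
  proof -
    have c: "rel m `` {u} \<in> simplices (pushout K A B f g) m"
      unfolding simplices_pushout by (rule quotientI[OF u])
    then show "F m (rel m `` {u}) \<in> simplices X m" using F by (simp add: sset_map_def)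
    assume \<beta>: "\<beta> \<in> simplex_maps k m"
    then show "F k (rel k `` {act k m \<beta> u}) = action X k m \<beta> (F m (rel m `` {u}))"
      using F c unfolding action_class[OF u \<beta>, symmetric] by (simp add: sset_map_def)
  qed
  show "sset_map A X (\<lambda>m x. F m (rel m `` {Inl x}))"
    using *(1)[OF InlI] *(2)[OF InlI] by (auto simp: sset_map_def)
  show "sset_map B X (\<lambda>m y. F m (rel m `` {Inr y}))"
    using *(1)[OF InrI] *(2)[OF InrI] by (auto simp: sset_map_def)
qed

lemma sset_map_from_pushout:
  assumes FA: "sset_map A X FA" and FB: "sset_map B X FB"
    and glue: "\<And>m x. x \<in> simplices K m \<Longrightarrow> FA m (f m x) = FB m (g m x)"
  obtains G where "sset_map (pushout K A B f g) X G"
    "\<And>m u. u \<in> U m \<Longrightarrow> G m (rel m `` {u}) = case_sum (FA m) (FB m) u"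
proof -
  define G where "G = (\<lambda>m c. case_sum (FA m) (FB m) (SOME u. u \<in> c))"
  have G: "G m (rel m `` {u}) = case_sum (FA m) (FB m) u" if "u \<in> U m" for m u
  proof -
    have "u \<in> rel m `` {u}" by (rule equiv_class_self[OF equiv_pushout_rel that])
    then have "(SOME u'. u' \<in> rel m `` {u}) \<in> rel m `` {u}" by (rule someI)
    then have "(u, SOME u'. u' \<in> rel m `` {u}) \<in> rel m" by blast
    from pushout_rel_eq[OF this, of "case_sum (FA m) (FB m)"] show ?thesis
      using glue by (simp add: G_def)
  qed
  have "sset_map (pushout K A B f g) X G"
    unfolding sset_map_def simplices_pushout
  proof (intro conjI allI ballI)
    fix m c assume "c \<in> U m // rel m"
    then obtain u where "c = rel m `` {u}" "u \<in> U m" by (rule quotientE)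
    then show "G m c \<in> simplices X m"
      using FA FB by (auto simp: G sset_map_def)
  next
    fix k m \<beta> c assume \<beta>: "\<beta> \<in> simplex_maps k m" and "c \<in> U m // rel m"
    then obtain u where c: "c = rel m `` {u}" and u: "u \<in> U m" by (auto elim: quotientE)
    have "G k (action (pushout K A B f g) k m \<beta> c) = case_sum (FA k) (FB k) (act k m \<beta> u)"
      unfolding c action_class[OF u \<beta>] by (rule G[OF act_closed[OF \<beta> u]])
    also have "\<dots> = action X k m \<beta> (case_sum (FA m) (FB m) u)"
      using FA FB u \<beta> by (auto simp: sset_map_def)
    finally show "G k (action (pushout K A B f g) k m \<beta> c) = action X k m \<beta> (G m c)"
      unfolding c G[OF u] .
  qed
  then show thesis using G by (rule that)
qed

end

section \<open>The squares that glue on \<open>J\<close>, and the theorem\<close>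

lemma simplices_J: "y \<in> simplices J m \<longleftrightarrow> (\<exists>\<gamma>\<in>{..m} \<rightarrow>\<^sub>E {..1}. y = J_edge m \<gamma>)"
proof
  assume "y \<in> simplices J m"
  then have "fst y \<in> {..m} \<rightarrow>\<^sub>E {0, 1}"
    by (simp add: J_def nerve_def free_iso_def case_prod_beta mem_Times_iff)
  moreover have "{0, 1} = {..1::nat}" by auto
  moreover have "y = J_edge m (fst y)" by (cases y) (simp add: J_edge_def fun_eq_iff)
  ultimately show "\<exists>\<gamma>\<in>{..m} \<rightarrow>\<^sub>E {..1}. y = J_edge m \<gamma>" by metis
qed (use J_edge_in_J in blast)

text \<open>The general family \<open>T\<close> covers both the horn and, with \<open>UNIV\<close>,
  the full simplex.\<close>

lemma pushout_square_augment:
  assumes down: "\<And>V W. V \<in> T \<Longrightarrow> W \<subseteq> V \<Longrightarrow> W \<in> T" and "{j, j + 1} \<in> T" "j + 1 \<le> n"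
  shows "pushout_square (std_simplex 1) (subcomplex n T) J
    (classifying_map (subcomplex n T) 1 (edge j)) J_edge"
proof
  fix k m \<beta> assume \<beta>: "\<beta> \<in> simplex_maps k m"
  show "action (std_simplex 1) k m \<beta> x \<in> simplices (std_simplex 1) k"
    if "x \<in> simplices (std_simplex 1) m" for x
    using simplex_maps_compose[OF \<beta>] that by (simp add: std_simplex_def)
  show "action (subcomplex n T) k m \<beta> x \<in> simplices (subcomplex n T) k"
    if "x \<in> simplices (subcomplex n T) m" for x
    using simplex_maps_compose[OF \<beta>] down[OF _ image_compose_subset[OF \<beta>]] that
    by (auto simp: std_simplex_def subcomplex_def)
  show "action J k m \<beta> y \<in> simplices J k" if y: "y \<in> simplices J m" for y
  proof -
    obtain \<gamma> where \<gamma>: "\<gamma> \<in> {..m} \<rightarrow>\<^sub>E {..1}" "y = J_edge m \<gamma>"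
      using y unfolding simplices_J by blast
    have "compose {..k} \<gamma> \<beta> \<in> {..k} \<rightarrow>\<^sub>E {..1}"
      using image_simplex_map[OF \<beta>] \<gamma>(1) by (auto simp: compose_def)
    then show ?thesis unfolding \<gamma>(2) action_J_edge by (rule J_edge_in_J)
  qed
next
  have "edge j \<in> simplex_maps 1 n"
    using assms(3) by (auto simp: simplex_maps_def edge_def monotone_on_def)
  moreover have "edge j ` {..1} = {j, j + 1}"
    by (auto simp: edge_def image_iff le_Suc_eq)
  ultimately have e: "edge j \<in> simplex_maps 1 n" "edge j ` {..1} \<in> T" using assms(2) by auto
  show "sset_map (std_simplex 1) (subcomplex n T) (classifying_map (subcomplex n T) 1 (edge j))"
    unfolding sset_map_def
  proof (intro conjI allI ballI)
    fix m \<gamma> assume "\<gamma> \<in> simplices (std_simplex 1) m"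
    then have \<gamma>: "\<gamma> \<in> simplex_maps m 1" by (simp add: std_simplex_def)
    show "classifying_map (subcomplex n T) 1 (edge j) m \<gamma> \<in> simplices (subcomplex n T) m"
      using simplex_maps_compose[OF \<gamma> e(1)] down[OF e(2) image_compose_subset[OF \<gamma>]]
      by (simp add: classifying_map_def subcomplex_def std_simplex_def)
    fix k \<beta> assume \<beta>: "\<beta> \<in> simplex_maps k m"
    show "classifying_map (subcomplex n T) 1 (edge j) k (action (std_simplex 1) k m \<beta> \<gamma>) =
        action (subcomplex n T) k m \<beta> (classifying_map (subcomplex n T) 1 (edge j) m \<gamma>)"
      by (simp add: classifying_map_def subcomplex_def std_simplex_def
          compose_simplex_assoc[OF \<beta>])
  qed
  show "sset_map (std_simplex 1) J J_edge"
    unfolding sset_map_def action_J_edge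
    by (auto simp: std_simplex_def simplex_maps_def intro!: J_edge_in_J)
qed

theorem proposition6p2:
  fixes X :: "'a sset" and n i j :: nat
  assumes "quasi_2_segal X"
    and "n \<ge> 2" and "i \<le> n" and "j = i \<or> j + 1 = i" and "j + 1 \<le> n"
  shows "extends_along (J_horn n i j) (J_std_simplex n j) (J_horn_inclusion n j) X"
  unfolding extends_along_def
proof (intro allI impI)
  fix F assume F: "sset_map (J_horn n i j) X F"
  let ?T = "{S. \<exists>l\<in>{..n} - {i}. l \<notin> S}"
  let ?H = "subcomplex n ?T" and ?D = "subcomplex n UNIV"
  have horn: "horn n i = ?H" by (simp add: horn_def union_of_faces_eq_subcomplex)
  \<comment> \<open>A vertex off the edge, available as \<open>n \<ge> 2\<close>: the edge lies in
    the face opposite to it, hence in the horn.\<close>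
  obtain l where l: "l \<le> n" "l \<noteq> j" "l \<noteq> j + 1"
  proof (rule that)
    show "(if j = 0 then 2 else 0) \<le> n" using assms(2) by simp
  qed auto
  have "{j, j + 1} \<in> ?T" using l assms(4) by auto
  then interpret H: pushout_square "std_simplex 1" ?H J "classifying_map ?H 1 (edge j)" J_edge
    by (intro pushout_square_augment) (use assms(5) in auto)
  interpret D: pushout_square "std_simplex 1" ?D J "classifying_map ?D 1 (edge j)" J_edge
    by (intro pushout_square_augment) (use assms(5) in auto)
  have classifying: "classifying_map (subcomplex n T) 1 (edge j) m \<gamma> = compose {..m} (edge j) \<gamma>"
    for T m \<gamma>
    by (simp add: classifying_map_def subcomplex_def std_simplex_def)
  have F': "sset_map (pushout (std_simplex 1) ?H J (classifying_map ?H 1 (edge j)) J_edge) X F"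
    using F by (simp add: J_horn_def augment_def horn)
  define FA where "FA = (\<lambda>m x. F m (H.rel m `` {Inl x}))"
  define FJ where "FJ = (\<lambda>m y. F m (H.rel m `` {Inr y}))"
  have FA: "sset_map ?H X FA" and FJ: "sset_map J X FJ"
    using H.sset_map_inclusions[OF F'] by (simp_all add: FA_def FJ_def)
  have glue: "FA m (compose {..m} (edge j) \<gamma>) = FJ m (J_edge m \<gamma>)"
    if "\<gamma> \<in> simplex_maps m 1" for m \<gamma>
  proof -
    have "\<gamma> \<in> simplices (std_simplex 1) m" using that by (simp add: std_simplex_def)
    from H.class_Inl_eq_Inr[OF this] show ?thesis by (simp only: FA_def FJ_def classifying)
  qed
  interpret J_horn_map X n i j FA FJ
    by unfold_locales (use assms FA FJ glue in auto)
  obtain G where G: "sset_map (std_simplex n) X G"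
    "\<forall>m \<alpha> l. \<alpha> \<in> simplex_maps m n \<longrightarrow> l \<in> {..n} - {i} \<longrightarrow> l \<notin> \<alpha> ` {..m} \<longrightarrow> G m \<alpha> = FA m \<alpha>"
    using fill_horn by blast
  have GH: "G m x = FA m x" if "x \<in> simplices ?H m" for m x
    using that G(2) by (auto simp: subcomplex_def)
  \<comment> \<open>The filler \<open>G\<close> still agrees with \<open>FJ\<close> on the edge,
    which lies in the horn, where \<open>G\<close> is \<open>FA\<close>.\<close>
  obtain G' where G': "sset_map (pushout (std_simplex 1) ?D J (classifying_map ?D 1 (edge j)) J_edge) X G'"
    "\<And>m u. u \<in> D.U m \<Longrightarrow> G' m (D.rel m `` {u}) = case_sum (G m) (FJ m) u"
  proof (rule D.sset_map_from_pushout[of X G FJ])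
    show "sset_map ?D X G" using G(1) by (simp only: subcomplex_UNIV)
    fix m x assume x: "x \<in> simplices (std_simplex 1) m"
    have "classifying_map ?H 1 (edge j) m x \<in> simplices ?H m"
      using H.f x by (auto simp: sset_map_def)
    then show "G m (classifying_map ?D 1 (edge j) m x) = FJ m (J_edge m x)"
      using GH glue[of x m] x unfolding classifying by (simp add: std_simplex_def)
  qed (use FJ in auto)
  have "G' m (J_horn_inclusion n j m c) = F m c" if "c \<in> simplices (J_horn n i j) m" for m c
  proof -
    have "c \<in> H.U m // H.rel m"
      using that by (simp only: J_horn_def augment_def horn H.simplices_pushout)
    then obtain u where c: "c = H.rel m `` {u}" and u: "u \<in> H.U m" by (rule quotientE)
    \<comment> \<open>Horn simplices are literally simplices of \<open>\<Delta>[n]\<close>, so each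
      class of the horn pushout lies in one class of the other, and the inclusion sends
      \<open>c\<close> to the class of its representative \<open>u\<close>.\<close>
    have UU: "H.U m \<subseteq> D.U m" by (auto simp: subcomplex_def)
    have "H.rel m \<subseteq> D.rel m"
      using UU unfolding pushout_rel_def Let_def classifying by blast
    moreover have "u \<in> c" unfolding c by (rule equiv_class_self[OF equiv_pushout_rel u])
    ultimately have "D.rel m `` c = D.rel m `` {u}"
      using equiv_pushout_rel[THEN equivE] unfolding c by (blast dest: transD)
    moreover have "J_horn_inclusion n j m c = D.rel m `` c"
      by (simp add: J_horn_inclusion_def augment_map_def augment_rel_def subcomplex_UNIV
          sum.map_id0[unfolded id_def] id_def)
    ultimately have "G' m (J_horn_inclusion n j m c) = case_sum (G m) (FJ m) u"
      using G'(2)[OF subsetD[OF UU u]] by simp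
    also have "\<dots> = F m c"
      using u GH by (auto simp: c FA_def FJ_def)
    finally show ?thesis .
  qed
  moreover have "sset_map (J_std_simplex n j) X G'"
    using G'(1) by (simp add: J_std_simplex_def augment_def subcomplex_UNIV)
  ultimately show "\<exists>G. sset_map (J_std_simplex n j) X G \<and>
      (\<forall>m. \<forall>x\<in>simplices (J_horn n i j) m. G m (J_horn_inclusion n j m x) = F m x)"
    by blast
qed

end
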